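(* Let $G=(S,T;E)$ be a bipartite graph with $|S|=n$, $w:E\to\mathbb R_+$, $d\in\mathbb N$ and $b:S\cup T\to\mathbb Z_+\cup\{\infty\}$. Consider the following randomized algorithm (Algorithm 2): define $b'(v)=b(v)$ for $v\in S$ and $b'(t)=\min\{\lceil n/d\rceil,b(t)\}$ for $t\in T$; find a maximum-weight $b'$-matching $\widehat M$ of $G$; generate a permutation $s_1,\dots,s_n$ of $S$ uniformly at random; let $M$ consist of all edges $s_it\in\widehat M$ such that none of $s_{\max\{1,i-d+1\}}t,\dots,s_{i-1}t$ belongs to $\widehat M$; output $s_1,\dots,s_n$ and $M$. Then $M$ is a feasible $d$-distance $b$-matching under the output ordering whose expected weight is at least $\frac1e$ times the maximum, over all orderings of $S$, of the weight of a heaviest $d$-distance $b$-matching under that ordering. This lower bound is tight.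
   Context: For an ordering $s_1,\dots,s_n$ of $S$, an edge set $M\subseteq E$ is a $d$-distance $b$-matching if every $v\in S\cup T$ has degree at most $b(v)$ in $M$ and whenever $s_it,s_jt\in M$ with $i\ne j$, $|i-j|\ge d$. A $b'$-matching is an edge set in which every node $v$ has degree at most $b'(v)$. $e$ is Euler's number. *)

theory Defs
  imports "HOL-Probability.Probability"
begin

definition bipartite_graph :: "'v set \<Rightarrow> 'v set \<Rightarrow> ('v \<times> 'v) set \<Rightarrow> bool" where
  "bipartite_graph S T E \<longleftrightarrow> finite S \<and> finite T \<and> S \<inter> T = {} \<and> E \<subseteq> S \<times> T"

definition node_degree :: "('v \<times> 'v) set \<Rightarrow> 'v \<Rightarrow> nat" where
  "node_degree M v = card {e \<in> M. fst e = v \<or> snd e = v}"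

definition b_matching ::
    "'v set \<Rightarrow> 'v set \<Rightarrow> ('v \<times> 'v) set \<Rightarrow> ('v \<Rightarrow> enat) \<Rightarrow> ('v \<times> 'v) set \<Rightarrow> bool" where
  "b_matching S T E b M \<longleftrightarrow> M \<subseteq> E \<and> (\<forall>v\<in>S \<union> T. enat (node_degree M v) \<le> b v)"

definition max_weight_b_matching ::
    "'v set \<Rightarrow> 'v set \<Rightarrow> ('v \<times> 'v) set \<Rightarrow> ('v \<times> 'v \<Rightarrow> real) \<Rightarrow> ('v \<Rightarrow> enat) \<Rightarrow> ('v \<times> 'v) set \<Rightarrow> bool" where
  "max_weight_b_matching S T E w b M \<longleftrightarrow>
     b_matching S T E b M \<and> (\<forall>N. b_matching S T E b N \<longrightarrow> sum w N \<le> sum w M)"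

(* An ordering of S is a list xs in permutations_of_set S; its i-th node (counted from 1)
   is xs ! (i - 1). Positions enter the distance condition only through differences. *)
definition distance_b_matching ::
    "'v set \<Rightarrow> 'v set \<Rightarrow> ('v \<times> 'v) set \<Rightarrow> nat \<Rightarrow> ('v \<Rightarrow> enat) \<Rightarrow> 'v list \<Rightarrow> ('v \<times> 'v) set \<Rightarrow> bool" where
  "distance_b_matching S T E d b xs M \<longleftrightarrow>
     b_matching S T E b M \<and>
     (\<forall>t. \<forall>i<length xs. \<forall>j<length xs.
        (xs ! i, t) \<in> M \<and> (xs ! j, t) \<in> M \<and> i \<noteq> j \<longrightarrow> int d \<le> \<bar>int i - int j\<bar>)"

definition max_distance_b_matching_weight ::
    "'v set \<Rightarrow> 'v set \<Rightarrow> ('v \<times> 'v) set \<Rightarrow> ('v \<times> 'v \<Rightarrow> real) \<Rightarrow> nat \<Rightarrow> ('v \<Rightarrow> enat) \<Rightarrow> real" where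
  "max_distance_b_matching_weight S T E w d b =
     (MAX xs\<in>permutations_of_set S. MAX M\<in>{M. distance_b_matching S T E d b xs M}. sum w M)"

definition reduced_bound ::
    "'v set \<Rightarrow> 'v set \<Rightarrow> nat \<Rightarrow> ('v \<Rightarrow> enat) \<Rightarrow> 'v \<Rightarrow> enat" where
  "reduced_bound S T d b v =
     (if v \<in> T then min (enat (nat \<lceil>real (card S) / real d\<rceil>)) (b v) else b v)"

(* With positions counted from 0, the d - 1 predecessors of position i form the interval
   {i + 1 - d..<i}; truncated subtraction on nat cuts it off at the first position. *)
definition thin_out :: "nat \<Rightarrow> ('v \<times> 'v) set \<Rightarrow> 'v list \<Rightarrow> ('v \<times> 'v) set" where
  "thin_out d Mhat xs =
     {(xs ! i, t) | i t. i < length xs \<and> (xs ! i, t) \<in> Mhat \<and>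
        (\<forall>j\<in>{i + 1 - d..<i}. (xs ! j, t) \<notin> Mhat)}"

(* Output distribution of the algorithm, given the maximum weight matching Mhat it has found
   with respect to the reduced bounds. *)
definition random_order_algorithm ::
    "'v set \<Rightarrow> nat \<Rightarrow> ('v \<times> 'v) set \<Rightarrow> ('v list \<times> ('v \<times> 'v) set) pmf" where
  "random_order_algorithm S d Mhat =
     map_pmf (\<lambda>xs. (xs, thin_out d Mhat xs)) (pmf_of_set (permutations_of_set S))"

definition expected_output_weight ::
    "'v set \<Rightarrow> ('v \<times> 'v \<Rightarrow> real) \<Rightarrow> nat \<Rightarrow> ('v \<times> 'v) set \<Rightarrow> real" where
  "expected_output_weight S w d Mhat =
     measure_pmf.expectation (random_order_algorithm S d Mhat) (\<lambda>(xs, M). sum w M)"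

(* Quantifying over all maximum weight matchings Mhat is never vacuous, and the two maxima
   in max_distance_b_matching_weight range over finite nonempty sets. *)
lemma max_weight_b_matching_exists:
  assumes "bipartite_graph S T E"
  shows "\<exists>M. max_weight_b_matching S T E w b M"
proof -
  let ?A = "{M. b_matching S T E b M}"
  have "finite E"
    using assms unfolding bipartite_graph_def by (metis finite_subset finite_cartesian_product)
  moreover have "?A \<subseteq> Pow E"
    by (auto simp: b_matching_def)
  ultimately have fin: "finite (sum w ` ?A)"
    by (meson finite_Pow_iff finite_imageI finite_subset)
  have "{} \<in> ?A"
    by (simp add: b_matching_def node_degree_def zero_enat_def[symmetric])
  then have "Max (sum w ` ?A) \<in> sum w ` ?A"
    using fin by (intro Max_in) auto
  then obtain M where "M \<in> ?A" "sum w M = Max (sum w ` ?A)"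
    by auto
  then have "max_weight_b_matching S T E w b M"
    using Max_ge[OF fin] unfolding max_weight_b_matching_def by simp
  then show ?thesis ..
qed

lemma distance_b_matchings_finite_nonempty:
  assumes "bipartite_graph S T E"
  shows "finite {M. distance_b_matching S T E d b xs M}"
    and "{M. distance_b_matching S T E d b xs M} \<noteq> {}"
proof -
  have "finite E"
    using assms unfolding bipartite_graph_def by (metis finite_subset finite_cartesian_product)
  moreover have "{M. distance_b_matching S T E d b xs M} \<subseteq> Pow E"
    by (auto simp: distance_b_matching_def b_matching_def)
  ultimately show "finite {M. distance_b_matching S T E d b xs M}"
    by (meson finite_Pow_iff finite_subset)
  have "distance_b_matching S T E d b xs {}"
    by (simp add: distance_b_matching_def b_matching_def node_degree_def zero_enat_def[symmetric])
  then show "{M. distance_b_matching S T E d b xs M} \<noteq> {}"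
    by blast
qed

end

theory Submission
  imports Defs
begin

text \<open>
  A node t of degree k = m + 1 in the matching found keeps each of its edges with probability
  1/k + (1 - 1/k) C(n-d+1, k) / C(n, k): condition on the position of the S-node and count the
  orderings in which the preceding window avoids the other neighbours of t. Since k is at most the
  ceiling of n/d, we have m d < n, every factor of the quotient of binomials is at least 1 - 1/m,
  and the probability is at least (1 + m (1 - 1/m)^(m+1)) / (m+1), which exceeds 1/e. On the other
  side, nodes at pairwise distance at least d have distinct quotients of their positions by d, so
  every d-distance b-matching is a b'-matching and the optimum is at most the weight of the matching
  found. For tightness take a star with n = k^2 leaves, d = k and unit weights: the optimum is k, and
  the kept fraction is at most 1/k + exp (1/k - 1).
\<close>

section \<open>Counting orderings that avoid a window\<close>

text \<open>Choose the positions of \<open>A \<inter> N\<close> among the last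
  \<open>card A - r\<close>, then order \<open>A \<inter> N\<close> and \<open>A - N\<close>
  independently. The induction strips the head of the list: it must lie in \<open>A - N\<close>, so
  its removal leaves \<open>A \<inter> N\<close> intact.\<close>

lemma card_permutations_prefix_avoiding:
  assumes "finite A" "r \<le> card A"
  shows "card {xs \<in> permutations_of_set A. set (take r xs) \<inter> N = {}} =
    (card A - r choose card (A \<inter> N)) * fact (card (A \<inter> N)) * fact (card (A - N))"
  using assms
proof (induction r arbitrary: A)
  case 0
  have "card (A \<inter> N) + card (A - N) = card A"
    using 0 by (metis Diff_Int_distrib2 Int_Diff card_Diff_subset_Int card_mono diff_add_inverse2 finite_Int inf_le1 le_add_diff_inverse)
  then have "card A - card (A \<inter> N) = card (A - N)" "card (A \<inter> N) \<le> card A"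
    by linarith+
  then show ?case
    using 0 binomial_fact_lemma[of "card (A \<inter> N)" "card A"] by (simp add: mult_ac)
next
  case (Suc r)
  let ?q = "card (A \<inter> N)"
  let ?P = "\<lambda>r A. {xs \<in> permutations_of_set A. set (take r xs) \<inter> N = {}}"
  have ne: "A \<noteq> {}"
    using Suc.prems by auto
  have split: "?P (Suc r) A = (\<Union>x\<in>A - N. (#) x ` ?P r (A - {x}))"
    by (subst permutations_of_set_nonempty[OF ne]) auto
  have "card (?P (Suc r) A) = (\<Sum>x\<in>A - N. card ((#) x ` ?P r (A - {x})))"
    unfolding split using Suc.prems by (subst card_UN_disjoint) auto
  also have "\<dots> = (\<Sum>x\<in>A - N. (card A - Suc r choose ?q) * fact ?q * fact (card (A - N) - 1))"
  proof (rule sum.cong[OF refl])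
    fix x assume x: "x \<in> A - N"
    then have "card ((#) x ` ?P r (A - {x})) = card (?P r (A - {x}))"
      by (intro card_image) auto
    also have "\<dots> = (card (A - {x}) - r choose card ((A - {x}) \<inter> N)) *
        fact (card ((A - {x}) \<inter> N)) * fact (card (A - {x} - N))"
      using Suc.prems x by (intro Suc.IH) auto
    also have "(A - {x}) \<inter> N = A \<inter> N"
      using x by auto
    also have "A - {x} - N = (A - N) - {x}"
      by auto
    finally show "card ((#) x ` ?P r (A - {x})) =
        (card A - Suc r choose ?q) * fact ?q * fact (card (A - N) - 1)"
      using x Suc.prems by simp
  qed
  also have "\<dots> = (card A - Suc r choose ?q) * fact ?q * (card (A - N) * fact (card (A - N) - 1))"
    by simp
  also have "\<dots> = (card A - Suc r choose ?q) * fact ?q * fact (card (A - N))"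
  proof (cases "card (A - N) = 0")
    \<comment> \<open>No admissible head exists, so the count is 0. The right-hand side vanishes as
      well, because all of \<open>card A\<close> elements would have to fit into fewer
      positions.\<close>
    case True
    then have "A \<inter> N = A"
      using Suc.prems by auto
    then show ?thesis
      using True Suc.prems by (simp add: binomial_eq_0)
  next
    case False
    then show ?thesis
      by (simp add: fact_reduce)
  qed
  finally show ?case .
qed

text \<open>The term for i counts the ways to place the m other neighbours of a node outside the
  window before position i; \<open>min\<close> accounts for windows cut off at the start. For
  \<open>e = 0\<close> all terms agree and the absorption identity applies. The step on e splits off
  i = 0, shifts the remaining terms to n - 1, and joins the two parts by Pascal's rule.\<close>

lemma sum_choose_truncated:
  "(\<Sum>i<n. (n - 1 - min i e) choose m) = (n choose Suc m) + m * ((n - e) choose Suc m)"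
proof (induction e arbitrary: n)
  case 0
  show ?case
  proof (cases n)
    case (Suc n')
    have "n * (n - 1 choose m) = Suc m * (n choose Suc m)"
      using Suc_times_binomial_eq[of n' m] Suc by (simp add: mult.commute)
    then show ?thesis
      by simp
  qed simp
next
  case (Suc e)
  show ?case
  proof (cases n)
    case (Suc n')
    then show ?thesis
      using Suc.IH[of n'] by (simp add: sum.lessThan_Suc_shift del: sum.lessThan_Suc)
  qed simp
qed

text \<open>With s fixed at position i, what remains is an ordering of \<open>S - {s}\<close> in
  which \<open>N - {s}\<close> avoids \<open>min i e\<close> given positions. Only the number of
  these positions matters, so the count for prefixes applies.\<close>

lemma card_permutations_window_avoiding:
  assumes "finite S" "s \<in> N" "N \<subseteq> S" "i < card S"
  shows "card {xs \<in> permutations_of_set S. xs ! i = s \<and> (\<forall>j\<in>{i - e..<i}. xs ! j \<notin> N)} =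
    (card S - 1 - min i e choose (card N - 1)) * fact (card N - 1) * fact (card S - card N)"
proof -
  let ?X = "{xs \<in> permutations_of_set S. xs ! i = s \<and> (\<forall>j\<in>{i - e..<i}. xs ! j \<notin> N)}"
  let ?Y = "{ys \<in> permutations_of_set (S - {s}). set (take (min i e) ys) \<inter> N = {}}"
  let ?f = "\<lambda>xs :: 'a list. rev (take i xs) @ drop (Suc i) xs"
  let ?g = "\<lambda>ys :: 'a list. rev (take i ys) @ s # drop i ys"
  have "s \<in> S"
    using assms by blast
  \<comment> \<open>After reversal the nearest predecessors come first.\<close>
  have window: "set (take (min i e) (rev (take i xs))) = (\<lambda>j. xs ! j) ` {i - e..<i}"
    if "i < length xs" for xs :: "'a list"
  proof -
    have "set (take (min i e) (rev (take i xs))) = set (drop (i - min i e) (take i xs))"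
      using that by (simp add: take_rev)
    also have "\<dots> = set (map ((!) xs) [i - min i e..<i])"
      using that by (intro arg_cong[where f = set] nth_equalityI) auto
    also have "i - min i e = i - e"
      by simp
    finally show ?thesis
      by simp
  qed
  \<comment> \<open>Deleting s and reversing what precedes it turns the window before position i into a prefix.\<close>
  have "bij_betw ?f ?X ?Y"
  proof (rule bij_betw_byWitness[where f' = ?g])
    have len: "length xs = card S" if "xs \<in> permutations_of_set S" for xs
      using that by (rule length_finite_permutations_of_set)
    have len': "length ys = card S - 1" if "ys \<in> permutations_of_set (S - {s})" for ys
      using length_finite_permutations_of_set[OF that] \<open>s \<in> S\<close> assms by simp
    show "\<forall>xs\<in>?X. ?g (?f xs) = xs"
      using assms(4) by (auto simp: len id_take_nth_drop[symmetric])
    show "\<forall>ys\<in>?Y. ?f (?g ys) = ys"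
      using assms(4) by (auto simp: len')
    show "?f ` ?X \<subseteq> ?Y"
    proof safe
      fix xs assume xs: "xs \<in> permutations_of_set S" "s = xs ! i" "\<forall>j\<in>{i - e..<i}. xs ! j \<notin> N"
      have l: "i < length xs"
        using xs assms len by simp
      have eq: "xs = take i xs @ xs ! i # drop (Suc i) xs"
        using l by (rule id_take_nth_drop)
      have "set xs = S" "distinct xs"
        using xs by (auto dest: permutations_of_setD)
      then have "distinct (take i xs @ xs ! i # drop (Suc i) xs)"
        "set (take i xs @ xs ! i # drop (Suc i) xs) = S"
        using eq by metis+
      then show "?f xs \<in> permutations_of_set (S - {xs ! i})"
        by (intro permutations_of_setI) auto
      fix x assume "x \<in> set (take (min i e) (?f xs))" "x \<in> N"
      moreover have "take (min i e) (?f xs) = take (min i e) (rev (take i xs))"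
        using l by simp
      ultimately show "x \<in> {}"
        using window[OF l] xs(3) by auto
    qed
    show "?g ` ?Y \<subseteq> ?X"
    proof safe
      fix ys assume ys: "ys \<in> permutations_of_set (S - {s})" "set (take (min i e) ys) \<inter> N = {}"
      have l: "length ys = card S - 1" "i \<le> length ys"
        using len'[OF ys(1)] assms by auto
      have "set ys = S - {s}" "distinct ys"
        using ys by (auto dest: permutations_of_setD)
      moreover have "set ys = set (take i ys) \<union> set (drop i ys)"
        by (metis append_take_drop_id set_append)
      ultimately show "?g ys \<in> permutations_of_set S"
        using \<open>s \<in> S\<close> set_take_disj_set_drop_if_distinct[of ys i i]
        by (intro permutations_of_setI) auto
      show "?g ys ! i = s"
        using l by (simp add: nth_append)
      fix j assume j: "j \<in> {i - e..<i}" "?g ys ! j \<in> N"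
      have lg: "i < length (?g ys)"
        using l by simp
      have "take (min i e) (rev (take i (?g ys))) = take (min i e) ys"
        using l by (simp add: take_rev[symmetric])
      then have "?g ys ! j \<in> set (take (min i e) ys)"
        using window[OF lg] j by auto
      then show False
        using ys(2) j by blast
    qed
  qed
  then have "card ?X = card ?Y"
    by (rule bij_betw_same_card)
  also have "\<dots> = (card (S - {s}) - min i e choose card ((S - {s}) \<inter> N)) *
      fact (card ((S - {s}) \<inter> N)) * fact (card ((S - {s}) - N))"
    using \<open>s \<in> S\<close> assms by (intro card_permutations_prefix_avoiding) auto
  also have "(S - {s}) \<inter> N = N - {s}"
    using assms by auto
  also have "(S - {s}) - N = S - N"
    using assms by auto
  finally show ?thesis
    using \<open>s \<in> S\<close> assms by (simp add: card_Diff_subset finite_subset)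
qed

section \<open>Estimates for powers, exp 1 and quotients of binomials\<close>

lemma exp_1_ge: "27 / 10 \<le> exp (1 :: real)"
  using e_approx_32 by (simp add: abs_if split: if_splits)

text \<open>Here m + 1 is the degree of a node t. As \<open>(1 - 1 / m) ^ (m + 1)\<close> behaves
  like (1 - 3/(2m))/e, the claim approaches 5/2 \<le> e for large m, which leaves room for rational
  estimates. Small m are checked one by one with \<open>exp_1_ge\<close>.\<close>

lemma one_minus_inverse_power_ge:
  assumes "1 \<le> m"
  shows "real (Suc m) / exp 1 \<le> 1 + real m * (1 - 1 / real m) ^ Suc m"
proof (cases "m \<le> 5")
  case True
  have "real (Suc m) / exp 1 \<le> real (Suc m) / (27 / 10)"
    using exp_1_ge by (intro divide_left_mono) auto
  moreover from True assms consider "m = 1" | "m = 2" | "m = 3" | "m = 4" | "m = 5"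
    by linarith
  then have "real (Suc m) / (27 / 10) \<le> 1 + real m * (1 - 1 / real m) ^ Suc m"
    by cases (simp_all add: field_simps power_divide)
  ultimately show ?thesis
    by linarith
next
  case False
  define x where "x = real m"
  have x: "x \<ge> 6"
    using False by (simp add: x_def)
  have pos: "0 < 1 - 1 / x"
    using x by simp
  \<comment> \<open>Trapezoidal bound for the integral of 1/t; from m = 6 on it is sharp enough together with e \<ge> 2.7.\<close>
  have "ln x - ln (x - 1) \<le> (inverse (x - 1) + inverse x) / 2"
    using ln_inverse_approx_le[of "x - 1" 1] x by simp
  moreover have "ln (1 - 1 / x) = ln (x - 1) - ln x"
    using ln_div[of "x - 1" x] x by (simp add: diff_divide_distrib)
  ultimately have "- ((inverse (x - 1) + inverse x) / 2) \<le> ln (1 - 1 / x)"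
    by linarith
  then have "(x + 1) * (- ((inverse (x - 1) + inverse x) / 2)) \<le> (x + 1) * ln (1 - 1 / x)"
    using x by (intro mult_left_mono) auto
  moreover have "(x + 1) * (- ((inverse (x - 1) + inverse x) / 2)) = -1 - (3 * x - 1) / (2 * x * (x - 1))"
    using x by (simp add: divide_simps) algebra
  \<comment> \<open>The constant 17/10 is 27/10 - 1, the most that the final comparison can absorb
    using e \<ge> 27/10. The inequality is then equivalent to x \<ge> 6, whence the case split at
    5.\<close>
  moreover have "(3 * x - 1) / (2 * x * (x - 1)) \<le> (17 / 10) / x"
  proof -
    have "(3 * x - 1) / (2 * (x - 1)) \<le> 17 / 10"
      using x by (simp add: field_simps)
    then have "(3 * x - 1) / (2 * (x - 1)) / x \<le> (17 / 10) / x"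
      using x by (intro divide_right_mono) auto
    then show ?thesis
      by (simp add: mult_ac)
  qed
  ultimately have ln: "- 1 - (17 / 10) / x \<le> (x + 1) * ln (1 - 1 / x)"
    by linarith
  have "(1 - (17 / 10) / x) / exp 1 \<le> exp (- ((17 / 10) / x)) / exp 1"
    using exp_ge_add_one_self[of "- ((17 / 10) / x)"] by (intro divide_right_mono) auto
  also have "\<dots> = exp (- 1 - (17 / 10) / x)"
    by (simp only: exp_diff[symmetric]) (simp add: algebra_simps)
  also have "\<dots> \<le> exp ((x + 1) * ln (1 - 1 / x))"
    using ln by simp
  also have "\<dots> = (1 - 1 / x) ^ Suc m"
    using pos exp_of_nat_mult[of "Suc m" "ln (1 - 1 / x)"] by (simp add: x_def add.commute)
  finally have "x * ((1 - (17 / 10) / x) / exp 1) \<le> x * (1 - 1 / x) ^ Suc m"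
    using x by (intro mult_left_mono) auto
  moreover have "x * ((1 - (17 / 10) / x) / exp 1) = (x - 17 / 10) / exp 1"
    using x by (simp add: field_simps)
  moreover have "(x + 1) / exp 1 \<le> 1 + (x - 17 / 10) / exp 1"
    using exp_1_ge by (simp add: field_simps)
  ultimately show ?thesis
    by (simp add: x_def add.commute)
qed

lemma choose_ratio_eq_prod:
  assumes "k \<le> n - e" "e \<le> n"
  shows "real ((n - e) choose k) / real (n choose k) = (\<Prod>i<k. (real n - real e - real i) / (real n - real i))"
proof -
  have "real (n - e - i) = real n - real e - real i" "real (n - i) = real n - real i" if "i < k" for i
    using that assms by auto
  moreover have "real (k - i) \<noteq> 0" if "i < k" for i
    using that by simp
  ultimately show ?thesis
    using assms by (simp add: binomial_altdef_of_nat atLeast0LessThan diff_diff_eq flip: prod_dividef)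
qed

text \<open>Factor i of the product is 1 - (d-1)/(n-i). For i \<le> m, m(d-1) + i \<le> md < n, so
  the subtracted quotient is at most 1/m.\<close>

lemma choose_ratio_ge:
  assumes "1 \<le> m" "1 \<le> d" "m * d < n"
  shows "(1 - 1 / real m) ^ Suc m \<le> real (n - (d - 1) choose Suc m) / real (n choose Suc m)"
proof -
  obtain a b where ab: "m = Suc a" "d = Suc b"
    using assms by (metis not0_implies_Suc not_one_le_zero)
  \<comment> \<open>From (m-1)(d-1) \<ge> 0 follows m + d \<le> md + 1 \<le> n; writing m and d as
    successors exposes this to the simplifier.\<close>
  have "Suc m \<le> n - (d - 1)" "d - 1 \<le> n"
    using assms(3) unfolding ab by (simp_all add: algebra_simps)
  then have "real (n - (d - 1) choose Suc m) / real (n choose Suc m) =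
      (\<Prod>i<Suc m. (real n - real (d - 1) - real i) / (real n - real i))"
    by (rule choose_ratio_eq_prod)
  moreover have "(1 - 1 / real m) ^ Suc m = (\<Prod>i<Suc m. 1 - 1 / real m)"
    by simp
  moreover have "\<dots> \<le> (\<Prod>i<Suc m. (real n - real (d - 1) - real i) / (real n - real i))"
  proof (rule prod_mono, intro conjI)
    fix i assume "i \<in> {..<Suc m}"
    then have i: "i \<le> m"
      by simp
    show "0 \<le> 1 - 1 / real m"
      using assms by simp
    have "m * (d - 1) + i \<le> n"
      using assms i unfolding ab by simp
    then have le: "real m * real (d - 1) + real i \<le> real n"
      by (metis of_nat_add of_nat_le_iff of_nat_mult)
    have "i < n"
      using i assms by (metis le_trans linorder_not_less mult.right_neutral mult_le_mono2)
    then show "1 - 1 / real m \<le> (real n - real (d - 1) - real i) / (real n - real i)"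
      using le assms by (simp add: field_simps)
  qed
  ultimately show ?thesis
    by simp
qed

text \<open>The opposite estimate, for the tight example: each factor 1 - e/(n-i) is at most 1 -
  e/n, hence at most \<open>exp (- (e / n))\<close>.\<close>

lemma choose_ratio_le:
  assumes "k \<le> n - e" "e \<le> n" "0 < n"
  shows "real ((n - e) choose k) / real (n choose k) \<le> exp (- real k * real e / real n)"
proof -
  have "real ((n - e) choose k) / real (n choose k) = (\<Prod>i<k. (real n - real e - real i) / (real n - real i))"
    using assms by (intro choose_ratio_eq_prod)
  also have "\<dots> \<le> (\<Prod>i<k. exp (- (real e / real n)))"
  proof (rule prod_mono, intro conjI)
    fix i assume "i \<in> {..<k}"
    then have i: "i + e < n"
      using assms by simp
    then show "0 \<le> (real n - real e - real i) / (real n - real i)"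
      by (intro divide_nonneg_nonneg) linarith+
    have "(real n - real e - real i) / (real n - real i) \<le> 1 - real e / real n"
      using i by (simp add: field_simps)
    also have "\<dots> \<le> exp (- (real e / real n))"
      using exp_ge_add_one_self[of "- (real e / real n)"] by simp
    finally show "(real n - real e - real i) / (real n - real i) \<le> exp (- (real e / real n))" .
  qed
  also have "\<dots> = exp (- real k * real e / real n)"
    by (simp add: exp_of_nat_mult[symmetric])
  finally show ?thesis .
qed

section \<open>Survival probability of an edge and expected weight\<close>

text \<open>The probability that an edge st of the matching survives when t has degree k in it.\<close>
definition keep_prob :: "nat \<Rightarrow> nat \<Rightarrow> nat \<Rightarrow> real" where
  "keep_prob n d k =
     (1 + real (k - 1) * (real (n - (d - 1) choose k) / real (n choose k))) / real k"

text \<open>Sort the orderings that keep the edge by the position i of s, sum the window counts over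
  i, and divide by the number of all orderings.\<close>

lemma card_thin_out:
  assumes "finite S" "1 \<le> d" "{v. (v, t) \<in> M} \<subseteq> S" "(s, t) \<in> M"
  shows "real (card {xs \<in> permutations_of_set S. (s, t) \<in> thin_out d M xs}) / fact (card S) =
    keep_prob (card S) d (card {v. (v, t) \<in> M})"
proof -
  define n N where "n = card S" and "N = {v. (v, t) \<in> M}"
  let ?X = "\<lambda>i. {xs \<in> permutations_of_set S. xs ! i = s \<and> (\<forall>j\<in>{i - (d - 1)..<i}. xs ! j \<notin> N)}"
  have N: "N \<subseteq> S" "s \<in> N" "finite N"
    using assms finite_subset by (auto simp: N_def)
  then have "0 < card N" "card N \<le> n"
    using assms by (auto simp: card_gt_0_iff n_def intro: card_mono)
  then obtain m where m: "card N = Suc m" "Suc m \<le> n"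
    using not0_implies_Suc by fastforce
  have len: "length xs = n" if "xs \<in> permutations_of_set S" for xs
    using that unfolding n_def by (rule length_finite_permutations_of_set)
  \<comment> \<open>The window size \<open>e\<close> of the counting lemmas is \<open>d - 1\<close>;
    the two truncated subtractions agree because d \<ge> 1.\<close>
  have window: "i + 1 - d = i - (d - 1)" for i
    using assms by simp
  have "{xs \<in> permutations_of_set S. (s, t) \<in> thin_out d M xs} = (\<Union>i<n. ?X i)"
    using assms(4) unfolding thin_out_def window N_def by (auto simp: len)
  moreover have "card (\<Union>i<n. ?X i) = (\<Sum>i<n. card (?X i))"
  proof (rule card_UN_disjoint)
    show "\<forall>i\<in>{..<n}. \<forall>j\<in>{..<n}. i \<noteq> j \<longrightarrow> ?X i \<inter> ?X j = {}"
      by (auto simp: len nth_eq_iff_index_eq dest: permutations_of_setD)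
  qed auto
  moreover have "(\<Sum>i<n. card (?X i)) =
      (\<Sum>i<n. (n - 1 - min i (d - 1) choose m) * (fact m * fact (n - Suc m)))"
  proof (rule sum.cong[OF refl])
    fix i assume "i \<in> {..<n}"
    then show "card (?X i) = (n - 1 - min i (d - 1) choose m) * (fact m * fact (n - Suc m))"
      using card_permutations_window_avoiding[of S s N i "d - 1"] assms N m(1)
      by (simp add: n_def mult.assoc)
  qed
  moreover have "\<dots> = ((n choose Suc m) + m * (n - (d - 1) choose Suc m)) * (fact m * fact (n - Suc m))"
    by (simp only: sum_distrib_right[symmetric] sum_choose_truncated)
  ultimately have card: "real (card {xs \<in> permutations_of_set S. (s, t) \<in> thin_out d M xs}) =
      (real (n choose Suc m) + real m * real (n - (d - 1) choose Suc m)) * (fact m * fact (n - Suc m))"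
    by simp
  \<comment> \<open>Written this way, the number of orderings shares the factor
    \<open>fact m * fact (n - Suc m)\<close> with the count, and it cancels.\<close>
  have fact: "(fact n :: real) = real (Suc m) * real (n choose Suc m) * (fact m * fact (n - Suc m))"
    using binomial_fact_lemma[OF m(2), THEN arg_cong[where f = real]]
    by (simp add: algebra_simps)
  have "real (n choose Suc m) \<noteq> 0"
    using m by simp
  then show ?thesis
    unfolding card n_def[symmetric] N_def[symmetric] fact m(1) keep_prob_def
    by (simp add: divide_simps del: binomial_Suc_Suc of_nat_Suc)
qed

lemma thin_out_subset: "thin_out d M xs \<subseteq> M"
  by (auto simp: thin_out_def)

text \<open>Linearity of expectation: after swapping the sums over orderings and edges, each edge
  contributes its weight times the fraction of orderings that keep it.\<close>

lemma expected_output_weight_eq: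
  assumes "finite S" "finite M" "fst ` M \<subseteq> S" "1 \<le> d"
  shows "expected_output_weight S w d M =
    (\<Sum>(s, t)\<in>M. w (s, t) * keep_prob (card S) d (card {v. (v, t) \<in> M}))"
proof -
  let ?P = "permutations_of_set S"
  have "expected_output_weight S w d M = (\<Sum>xs\<in>?P. sum w (thin_out d M xs)) / card ?P"
    using assms unfolding expected_output_weight_def random_order_algorithm_def
    by (simp add: integral_pmf_of_set)
  also have "(\<Sum>xs\<in>?P. sum w (thin_out d M xs)) = (\<Sum>xs\<in>?P. \<Sum>e\<in>M. if e \<in> thin_out d M xs then w e else 0)"
    using assms(2) thin_out_subset[of d M]
    by (simp add: sum.inter_restrict[symmetric] Int_absorb1)
  also have "\<dots> = (\<Sum>e\<in>M. \<Sum>xs\<in>?P. if e \<in> thin_out d M xs then w e else 0)"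
    by (rule sum.swap)
  also have "\<dots> = (\<Sum>e\<in>M. w e * real (card {xs \<in> ?P. e \<in> thin_out d M xs}))"
    by (intro sum.cong refl) (simp add: sum.If_cases Int_def mult.commute)
  also have "\<dots> / card ?P = (\<Sum>e\<in>M. w e * (real (card {xs \<in> ?P. e \<in> thin_out d M xs}) / fact (card S)))"
    using assms by (simp add: sum_divide_distrib)
  also have "\<dots> = (\<Sum>(s, t)\<in>M. w (s, t) * keep_prob (card S) d (card {v. (v, t) \<in> M}))"
  proof (rule sum.cong[OF refl], clarify)
    fix s t assume "(s, t) \<in> M"
    moreover have "{v. (v, t) \<in> M} \<subseteq> S"
      using assms(3) by force
    ultimately show "w (s, t) * (real (card {xs \<in> ?P. (s, t) \<in> thin_out d M xs}) / fact (card S)) =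
        w (s, t) * keep_prob (card S) d (card {v. (v, t) \<in> M})"
      using assms by (subst card_thin_out) auto
  qed
  finally show ?thesis .
qed

text \<open>With m = k - 1, the ceiling bound on k says m < n/d, which is the hypothesis md < n of
  \<open>choose_ratio_ge\<close>.\<close>

lemma keep_prob_ge:
  assumes "1 \<le> d" "1 \<le> k" "k \<le> nat \<lceil>real n / real d\<rceil>"
  shows "1 / exp 1 \<le> keep_prob n d k"
proof -
  obtain m where k: "k = Suc m"
    using assms not0_implies_Suc by fastforce
  have "int m < \<lceil>real n / real d\<rceil>"
    using assms(3) by (simp add: k)
  then have "real m * real d < real n"
    using assms(1) by (simp add: less_ceiling_iff pos_less_divide_eq)
  then have md: "m * d < n"
    by (metis of_nat_less_iff of_nat_mult)
  have "real (Suc m) / exp 1 \<le> 1 + real m * (real (n - (d - 1) choose Suc m) / real (n choose Suc m))"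
  proof (cases "m = 0")
    \<comment> \<open>Degree 1 is treated apart because the estimate involves 1/m; such an edge is
      always kept.\<close>
    case True
    then show ?thesis
      by simp
  next
    case False
    then have "real (Suc m) / exp 1 \<le> 1 + real m * (1 - 1 / real m) ^ Suc m"
      by (intro one_minus_inverse_power_ge) simp
    also have "\<dots> \<le> 1 + real m * (real (n - (d - 1) choose Suc m) / real (n choose Suc m))"
      using choose_ratio_ge[of m d n] False assms(1) md by (intro add_left_mono mult_left_mono) auto
    finally show ?thesis .
  qed
  then show ?thesis
    by (simp add: keep_prob_def k field_simps del: binomial_Suc_Suc of_nat_Suc)
qed

section \<open>Feasibility of the output and upper bound on the optimum\<close>

lemma node_degree_right:
  assumes "M \<subseteq> S \<times> T" "S \<inter> T = {}" "t \<in> T"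
  shows "node_degree M t = card {v. (v, t) \<in> M}"
proof -
  have "{e \<in> M. fst e = t \<or> snd e = t} = (\<lambda>v. (v, t)) ` {v. (v, t) \<in> M}"
    using assms by force
  then show ?thesis
    by (simp add: node_degree_def card_image inj_on_def)
qed

lemma node_degree_mono:
  assumes "finite M" "N \<subseteq> M"
  shows "node_degree N v \<le> node_degree M v"
  unfolding node_degree_def using assms by (intro card_mono) auto

lemma bipartite_graph_finite_edges: "bipartite_graph S T E \<Longrightarrow> finite E"
  unfolding bipartite_graph_def by (metis finite_subset finite_cartesian_product)

text \<open>Thinning only lowers degrees, and \<open>reduced_bound\<close> is at most b. For the
  distances, consider the later of two kept edges at t: its window contains no neighbour of t in M,
  so the earlier one lies at least d positions before it.\<close>

lemma distance_b_matching_thin_out: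
  assumes "bipartite_graph S T E" "1 \<le> d" "b_matching S T E (reduced_bound S T d b) M"
    "xs \<in> permutations_of_set S"
  shows "distance_b_matching S T E d b xs (thin_out d M xs)"
  unfolding distance_b_matching_def
proof (intro conjI allI impI)
  have M: "M \<subseteq> E" "finite M"
    using assms(3) bipartite_graph_finite_edges[OF assms(1)] finite_subset
    unfolding b_matching_def by blast+
  have "enat (node_degree (thin_out d M xs) v) \<le> b v" if "v \<in> S \<union> T" for v
  proof -
    have "enat (node_degree (thin_out d M xs) v) \<le> enat (node_degree M v)"
      using node_degree_mono[OF M(2) thin_out_subset] by simp
    also have "\<dots> \<le> reduced_bound S T d b v"
      using assms that by (auto simp: b_matching_def)
    also have "\<dots> \<le> b v"
      by (simp add: reduced_bound_def)
    finally show ?thesis .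
  qed
  then show "b_matching S T E b (thin_out d M xs)"
    using M thin_out_subset[of d M xs] by (auto simp: b_matching_def)
  have dist: "distinct xs"
    using assms by (auto dest: permutations_of_setD)
  have far: "d \<le> j - i" if "(xs ! i, t) \<in> thin_out d M xs" "(xs ! j, t) \<in> thin_out d M xs"
    "i < j" "j < length xs" for i j t
  proof -
    have "(xs ! i, t) \<in> M"
      using that thin_out_subset by blast
    \<comment> \<open>Distinctness identifies the index hidden in the set comprehension of
      \<open>thin_out\<close> with j.\<close>
    moreover have "\<forall>l\<in>{j + 1 - d..<j}. (xs ! l, t) \<notin> M"
      using that dist by (auto simp: thin_out_def nth_eq_iff_index_eq)
    ultimately have "i \<notin> {j + 1 - d..<j}"
      by blast
    then show ?thesis
      using that(3) by auto
  qed
  fix t i j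
  assume "i < length xs" "j < length xs"
    "(xs ! i, t) \<in> thin_out d M xs \<and> (xs ! j, t) \<in> thin_out d M xs \<and> i \<noteq> j"
  then show "int d \<le> \<bar>int i - int j\<bar>"
    using far[of i t j] far[of j t i] by (cases "i < j") auto
qed

text \<open>Cut the ordering into blocks of d consecutive positions, the last possibly shorter. Each
  block holds at most one neighbour of t, so capping the bound at the number of blocks excludes no
  feasible matching, whatever the ordering.\<close>

lemma distance_b_matching_imp_reduced:
  assumes "bipartite_graph S T E" "1 \<le> d" "xs \<in> permutations_of_set S"
    "distance_b_matching S T E d b xs M"
  shows "b_matching S T E (reduced_bound S T d b) M"
proof -
  have M: "M \<subseteq> E" "E \<subseteq> S \<times> T" "S \<inter> T = {}" "finite S"
    and b: "\<And>v. v \<in> S \<union> T \<Longrightarrow> enat (node_degree M v) \<le> b v"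
    using assms by (auto simp: distance_b_matching_def b_matching_def bipartite_graph_def)
  have xs: "set xs = S" "distinct xs" "length xs = card S"
    using assms(3) by (auto dest: permutations_of_setD simp: length_finite_permutations_of_set)
  have "node_degree M t \<le> nat \<lceil>real (card S) / real d\<rceil>" if t: "t \<in> T" for t
  proof -
    let ?I = "{i. i < length xs \<and> (xs ! i, t) \<in> M}"
    have "{v. (v, t) \<in> M} = (!) xs ` ?I"
    proof (intro equalityI subsetI)
      fix v assume v: "v \<in> {v. (v, t) \<in> M}"
      then have "v \<in> set xs"
        using M(1,2) xs(1) by auto
      then show "v \<in> (!) xs ` ?I"
        using v by (auto simp: in_set_conv_nth)
    qed auto
    moreover have "inj_on ((!) xs) ?I"
      using xs(2) by (auto simp: inj_on_def nth_eq_iff_index_eq)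
    ultimately have "node_degree M t = card ?I"
      using node_degree_right[of M S T t] M t by (auto simp: card_image)
    also have "\<dots> \<le> card {..<nat \<lceil>real (card S) / real d\<rceil>}"
    proof (rule card_inj_on_le)
      show "inj_on (\<lambda>i. i div d) ?I"
      proof (rule inj_onI, rule ccontr)
        fix i j assume ij: "i \<in> ?I" "j \<in> ?I" "i div d = j div d" "i \<noteq> j"
        then have far: "int d \<le> \<bar>int i - int j\<bar>"
          using assms(4) unfolding distance_b_matching_def by blast
        \<comment> \<open>Within one block, positions differ by a difference of remainders, which is
          less than d.\<close>
        have "i = i div d * d + i mod d" "j = i div d * d + j mod d"
          using ij(3) by (metis div_mult_mod_eq)+
        moreover have "i mod d < d" "j mod d < d"
          using assms(2) by auto
        ultimately show False
          using far by linarith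
      qed
      show "(\<lambda>i. i div d) ` ?I \<subseteq> {..<nat \<lceil>real (card S) / real d\<rceil>}"
      proof clarsimp
        fix i assume "i < length xs"
        have "real (i div d) \<le> real i / real d"
          by (rule of_nat_div_le_of_nat)
        also have "\<dots> < real (card S) / real d"
          using \<open>i < length xs\<close> xs(3) assms(2) by (intro divide_strict_right_mono) auto
        finally have "int (i div d) < \<lceil>real (card S) / real d\<rceil>"
          by (simp add: less_ceiling_iff)
        then show "i div d < nat \<lceil>real (card S) / real d\<rceil>"
          by linarith
      qed
    qed simp
    finally show ?thesis
      by simp
  qed
  then show ?thesis
    using M(1) b by (auto simp: b_matching_def reduced_bound_def)
qed

lemma max_distance_b_matching_weight_le:
  assumes "bipartite_graph S T E" "1 \<le> d" "max_weight_b_matching S T E w (reduced_bound S T d b) M"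
  shows "max_distance_b_matching_weight S T E w d b \<le> sum w M"
proof -
  have "finite S"
    using assms by (simp add: bipartite_graph_def)
  then show ?thesis
    unfolding max_distance_b_matching_weight_def
    using distance_b_matchings_finite_nonempty[OF assms(1)]
      distance_b_matching_imp_reduced[OF assms(1,2)] assms(3)
    by (auto simp: max_weight_b_matching_def intro!: Max.boundedI)
qed

lemma le_max_distance_b_matching_weight:
  assumes "bipartite_graph S T E" "xs \<in> permutations_of_set S" "distance_b_matching S T E d b xs M"
  shows "sum w M \<le> max_distance_b_matching_weight S T E w d b"
proof -
  have "sum w M \<le> (MAX M\<in>{M. distance_b_matching S T E d b xs M}. sum w M)"
    using assms distance_b_matchings_finite_nonempty(1)[OF assms(1)] by (intro Max_ge) auto
  also have "\<dots> \<le> max_distance_b_matching_weight S T E w d b"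
    unfolding max_distance_b_matching_weight_def using assms by (intro Max_ge) auto
  finally show ?thesis .
qed

text \<open>Compare edge by edge: the degree bound in M makes every survival probability at least
  1/e, and nonnegative weights preserve this in the sum. The weight of M dominates the
  optimum.\<close>

lemma expected_output_weight_ge:
  assumes "bipartite_graph S T E" "\<forall>e\<in>E. 0 \<le> w e" "1 \<le> d"
    "max_weight_b_matching S T E w (reduced_bound S T d b) M"
  shows "1 / exp 1 * max_distance_b_matching_weight S T E w d b \<le> expected_output_weight S w d M"
proof -
  have G: "finite S" "S \<inter> T = {}" "E \<subseteq> S \<times> T"
    using assms by (auto simp: bipartite_graph_def)
  have M: "M \<subseteq> E" and deg: "\<And>v. v \<in> S \<union> T \<Longrightarrow> enat (node_degree M v) \<le> reduced_bound S T d b v"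
    using assms by (auto simp: max_weight_b_matching_def b_matching_def)
  have finM: "finite M"
    using M bipartite_graph_finite_edges[OF assms(1)] finite_subset by blast
  have "1 / exp 1 * max_distance_b_matching_weight S T E w d b \<le> 1 / exp 1 * sum w M"
    using max_distance_b_matching_weight_le[OF assms(1,3,4)] by (intro mult_left_mono) auto
  also have "\<dots> = (\<Sum>(s, t)\<in>M. w (s, t) * (1 / exp 1))"
    by (simp add: sum_divide_distrib)
  also have "\<dots> \<le> (\<Sum>(s, t)\<in>M. w (s, t) * keep_prob (card S) d (card {v. (v, t) \<in> M}))"
  proof (rule sum_mono, clarify)
    fix s t assume st: "(s, t) \<in> M"
    then have t: "t \<in> T" and w: "0 \<le> w (s, t)"
      using M G assms(2) by auto
    have "{v. (v, t) \<in> M} \<subseteq> S"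
      using M G by auto
    then have "finite {v. (v, t) \<in> M}"
      using G finite_subset by blast
    then have "1 \<le> card {v. (v, t) \<in> M}"
      using st by (auto simp: Suc_le_eq card_gt_0_iff)
    moreover have "card {v. (v, t) \<in> M} \<le> nat \<lceil>real (card S) / real d\<rceil>"
      using deg[of t] t node_degree_right[of M S T t] M G by (auto simp: reduced_bound_def)
    ultimately show "w (s, t) * (1 / exp 1) \<le> w (s, t) * keep_prob (card S) d (card {v. (v, t) \<in> M})"
      using w assms(3) by (intro mult_left_mono keep_prob_ge)
  qed
  also have "\<dots> = expected_output_weight S w d M"
    using G M finM assms(3) by (intro expected_output_weight_eq[symmetric]) auto
  finally show ?thesis .
qed

section \<open>Tightness on stars\<close>

text \<open>Leaves are labelled by their positions in \<open>[0..<k * k]\<close>, and the centre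
  takes the fresh label \<open>k * k\<close>. Every k-th leaf is matched.\<close>

lemma star_distance_b_matching:
  assumes "1 \<le> k"
  defines "M \<equiv> (\<lambda>i. (i * k, k * k)) ` {..<k}"
  shows "distance_b_matching {..<k * k} {k * k} ({..<k * k} \<times> {k * k}) k (\<lambda>_. \<infinity>) [0..<k * k] M"
proof -
  have "int k \<le> \<bar>int (i * k) - int (j * k)\<bar>" if "i \<noteq> j" for i j :: nat
  proof -
    have "int (i * k) - int (j * k) = (int i - int j) * int k"
      by (simp add: algebra_simps)
    moreover have "1 * int k \<le> \<bar>int i - int j\<bar> * int k"
      using that by (intro mult_right_mono) auto
    ultimately show ?thesis
      by (simp add: abs_mult)
  qed
  moreover have "i * k < k * k" if "i < k" for i
    using that assms by simp
  ultimately show ?thesis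
    by (auto simp: distance_b_matching_def b_matching_def M_def)
qed

text \<open>The reduced bound of the centre is k, so every maximum weight matching has exactly k
  edges and, by symmetry of the formula, the same expected output weight. The optimum is at least
  k.\<close>

lemma star_expected_output_weight_less:
  assumes "1 \<le> k" "1 / real k + exp (1 / real k - 1) < c"
  defines "S \<equiv> {..<k * k}" and "T \<equiv> {k * k}" and "w \<equiv> \<lambda>_ :: nat \<times> nat. 1 :: real"
    and "b \<equiv> \<lambda>_ :: nat. \<infinity> :: enat"
  assumes "max_weight_b_matching S T (S \<times> T) w (reduced_bound S T k b) M"
  shows "expected_output_weight S w k M < c * max_distance_b_matching_weight S T (S \<times> T) w k b"
proof -
  define M0 where "M0 = (\<lambda>i. (i * k, k * k)) ` {..<k}"
  have G: "bipartite_graph S T (S \<times> T)"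
    by (simp add: bipartite_graph_def S_def T_def)
  have M: "M \<subseteq> S \<times> T" and deg: "enat (node_degree M (k * k)) \<le> reduced_bound S T k b (k * k)"
    and max: "\<And>N. b_matching S T (S \<times> T) (reduced_bound S T k b) N \<Longrightarrow> sum w N \<le> sum w M"
    using assms(7) by (auto simp: max_weight_b_matching_def b_matching_def T_def)
  have finM: "finite M"
    using M finite_subset by (fastforce simp: S_def T_def)
  have xs: "[0..<k * k] \<in> permutations_of_set S"
    by (intro permutations_of_setI) (auto simp: S_def)
  have M0: "distance_b_matching S T (S \<times> T) k b [0..<k * k] M0"
    using star_distance_b_matching[OF assms(1)] by (simp add: S_def T_def b_def M0_def)
  have "card M0 = k"
    using assms(1) by (simp add: M0_def card_image inj_on_def)
  then have opt: "real k \<le> max_distance_b_matching_weight S T (S \<times> T) w k b"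
    using le_max_distance_b_matching_weight[OF G xs M0, of w] by (simp add: w_def)
  \<comment> \<open>\<open>M0\<close> respects the reduced bounds, so maximality of M applies to it;
    the bound at the centre gives the reverse inequality.\<close>
  have "real k \<le> real (card M)"
    using max[OF distance_b_matching_imp_reduced[OF G assms(1) xs M0]] \<open>card M0 = k\<close>
    by (simp add: w_def)
  moreover have "card M = card {v. (v, k * k) \<in> M}"
  proof (rule sym, rule bij_betw_same_card)
    show "bij_betw (\<lambda>v. (v, k * k)) {v. (v, k * k) \<in> M} M"
      using M by (auto simp: bij_betw_def inj_on_def T_def)
  qed
  moreover have "node_degree M (k * k) = card {v. (v, k * k) \<in> M}"
    using M by (intro node_degree_right[of M S T]) (auto simp: S_def T_def)
  then have "card {v. (v, k * k) \<in> M} \<le> k"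
    using deg assms(1) by (simp add: reduced_bound_def T_def S_def b_def)
  ultimately have k: "card {v. (v, k * k) \<in> M} = k" "card M = k"
    by auto
  have "expected_output_weight S w k M =
      (\<Sum>(s, t)\<in>M. w (s, t) * keep_prob (card S) k (card {v. (v, t) \<in> M}))"
    using M finM assms(1) by (intro expected_output_weight_eq) (auto simp: S_def)
  also have "\<dots> = (\<Sum>e\<in>M. keep_prob (k * k) k k)"
    using M k(1) by (intro sum.cong refl) (auto simp: w_def T_def S_def)
  \<comment> \<open>Summing k equal terms cancels the denominator k of
    \<open>keep_prob\<close>.\<close>
  also have "\<dots> = 1 + real (k - 1) * (real (k * k - (k - 1) choose k) / real (k * k choose k))"
    using assms(1) by (simp add: k(2) keep_prob_def)
  also have "\<dots> \<le> 1 + real k * exp (1 / real k - 1)"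
  proof -
    have "k - 1 \<le> k * k"
      by (metis diff_le_self le_square le_trans)
    moreover have "k \<le> k * k - (k - 1)"
      using assms(1) by (cases k) auto
    ultimately have "real (k * k - (k - 1) choose k) / real (k * k choose k)
        \<le> exp (- real k * real (k - 1) / real (k * k))"
      using assms(1) by (intro choose_ratio_le) auto
    also have "- real k * real (k - 1) / real (k * k) = 1 / real k - 1"
      using assms(1) by (simp add: field_simps of_nat_diff)
    \<comment> \<open>Besides the exponential bound, the factor k - 1 is relaxed to k.\<close>
    finally show ?thesis
      by (intro add_left_mono mult_mono) auto
  qed
  also have "\<dots> = (1 / real k + exp (1 / real k - 1)) * real k"
    using assms(1) by (simp add: field_simps)
  also have "\<dots> < c * real k"
    using assms(1,2) by (intro mult_strict_right_mono) auto
  also have "\<dots> \<le> c * max_distance_b_matching_weight S T (S \<times> T) w k b"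
  proof (rule mult_left_mono[OF opt])
    have "0 \<le> 1 / real k + exp (1 / real k - 1)"
      by (simp add: add_nonneg_nonneg)
    then show "0 \<le> c"
      using assms(2) by linarith
  qed
  finally show ?thesis .
qed

text \<open>As k grows the expression tends to exp (-1) = 1/e, which lies below c.\<close>

lemma star_ratio_eventually_less:
  assumes "1 / exp 1 < (c :: real)"
  shows "\<exists>k\<ge>1. 1 / real k + exp (1 / real k - 1) < c"
proof -
  have "(\<lambda>k. 1 / real k + exp (1 / real k - 1)) \<longlonglongrightarrow> 0 + exp (0 - 1)"
    by (intro tendsto_intros lim_1_over_n)
  then have "\<forall>\<^sub>F k in sequentially. 1 / real k + exp (1 / real k - 1) < c"
    using assms by (intro order_tendstoD(2)) (auto simp: exp_minus field_simps)
  then have "\<forall>\<^sub>F k in sequentially. 1 \<le> k \<and> 1 / real k + exp (1 / real k - 1) < c"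
    using eventually_ge_at_top[of 1] by eventually_elim auto
  then show ?thesis
    using eventually_happens by fastforce
qed

section \<open>Approximation guarantee and tightness combined\<close>

theorem theorem14:
  shows "(\<forall>(S :: 'v set) T E w d b Mhat.
            bipartite_graph S T E \<longrightarrow> (\<forall>e\<in>E. 0 \<le> w e) \<longrightarrow> 1 \<le> d \<longrightarrow>
            max_weight_b_matching S T E w (reduced_bound S T d b) Mhat \<longrightarrow>
              (\<forall>(xs, M) \<in> set_pmf (random_order_algorithm S d Mhat).
                 xs \<in> permutations_of_set S \<and> distance_b_matching S T E d b xs M) \<and>
              1 / exp 1 * max_distance_b_matching_weight S T E w d b
                \<le> expected_output_weight S w d Mhat) \<and>
         (\<forall>c > 1 / exp 1. \<exists>(S :: nat set) T E w d b.
            bipartite_graph S T E \<and> (\<forall>e\<in>E. 0 \<le> w e) \<and> 1 \<le> d \<and>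
            (\<forall>Mhat. max_weight_b_matching S T E w (reduced_bound S T d b) Mhat \<longrightarrow>
               expected_output_weight S w d Mhat
                 < c * max_distance_b_matching_weight S T E w d b))"
proof (intro conjI allI impI)
  fix S T :: "'v set" and E w d b Mhat
  assume G: "bipartite_graph S T E" and w: "\<forall>e\<in>E. 0 \<le> w e" and d: "1 \<le> d"
    and Mhat: "max_weight_b_matching S T E w (reduced_bound S T d b) Mhat"
  show "1 / exp 1 * max_distance_b_matching_weight S T E w d b \<le> expected_output_weight S w d Mhat"
    using G w d Mhat by (rule expected_output_weight_ge)
  have "finite S"
    using G by (simp add: bipartite_graph_def)
  then have "set_pmf (random_order_algorithm S d Mhat) =
      (\<lambda>xs. (xs, thin_out d Mhat xs)) ` permutations_of_set S"
    by (simp add: random_order_algorithm_def set_pmf_of_set)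
  then show "\<forall>(xs, M) \<in> set_pmf (random_order_algorithm S d Mhat).
      xs \<in> permutations_of_set S \<and> distance_b_matching S T E d b xs M"
    using distance_b_matching_thin_out[OF G d] Mhat by (auto simp: max_weight_b_matching_def)
next
  fix c :: real assume "1 / exp 1 < c"
  then obtain k :: nat where k: "1 \<le> k" "1 / real k + exp (1 / real k - 1) < c"
    using star_ratio_eventually_less by blast
  let ?S = "{..<k * k}" and ?T = "{k * k}"
  show "\<exists>(S :: nat set) T E w d b.
      bipartite_graph S T E \<and> (\<forall>e\<in>E. 0 \<le> w e) \<and> 1 \<le> d \<and>
      (\<forall>Mhat. max_weight_b_matching S T E w (reduced_bound S T d b) Mhat \<longrightarrow>
         expected_output_weight S w d Mhat
           < c * max_distance_b_matching_weight S T E w d b)"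
    using k(1) star_expected_output_weight_less[OF k]
    by (intro exI[of _ ?S] exI[of _ ?T] exI[of _ "?S \<times> ?T"] exI[of _ "\<lambda>_. 1"] exI[of _ k]
        exI[of _ "\<lambda>_. \<infinity>"]) (auto simp: bipartite_graph_def)
qed

end
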